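(* Let $d\ge2$ be an integer, let $p\in(0,1)$ be a fixed real number, let $p_1\in(0,1]$, and suppose that $p_j=p$ for all $j\ge2$. Let $E=\{z\in\mathbb{C}:\limsup_{j\to+\infty}|\tilde f_j(z)|<+\infty\}$. Then: (i) If $d$ is even, then $E$ is connected if and only if $p\ge\frac12$; otherwise $E$ is a Cantor set. (ii) If $d$ is odd, then $E$ is connected if and only if $p\ge\vartheta_d=d\,\theta_d^{\,d-1}$, where $\theta_d\in(0,1)$ is the unique non-negative solution of $$d\,x^{d-1}+(d-1)x^d-1=0;$$ otherwise $E$ is a Cantor set.
   Context: $f_j(z)=\left(\frac{z-(1-p_j)}{p_j}\right)^d$ for $j\ge1$, $z\in\mathbb{C}$, and $\tilde f_j=f_j\circ\cdots\circ f_1$. A Cantor set is a topological space homeomorphic to the standard middle-thirds Cantor set. *)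

theory Defs
  imports "HOL-Analysis.Analysis"
begin

definition step_map :: "nat \<Rightarrow> (nat \<Rightarrow> real) \<Rightarrow> nat \<Rightarrow> complex \<Rightarrow> complex" where
  "step_map d ps j z = ((z - (1 - of_real (ps j))) / of_real (ps j)) ^ d"

text \<open>The indices of the maps start at 1; the value at index 0 is the empty composition,
  and \<open>ps 0\<close> is never used.\<close>

primrec iter_map :: "nat \<Rightarrow> (nat \<Rightarrow> real) \<Rightarrow> nat \<Rightarrow> complex \<Rightarrow> complex" where
  "iter_map d ps 0 = id"
| "iter_map d ps (Suc j) = step_map d ps (Suc j) \<circ> iter_map d ps j"

text \<open>The limit superior is taken in the extended reals, where it always exists.\<close>

definition bounded_orbit_set :: "nat \<Rightarrow> (nat \<Rightarrow> real) \<Rightarrow> complex set" where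
  "bounded_orbit_set d ps = {z. limsup (\<lambda>j. ereal (cmod (iter_map d ps j z))) < \<infinity>}"

primrec middle_thirds_stage :: "nat \<Rightarrow> real set" where
  "middle_thirds_stage 0 = {0..1}"
| "middle_thirds_stage (Suc n) =
     (\<lambda>x. x / 3) ` middle_thirds_stage n \<union> (\<lambda>x. 2 / 3 + x / 3) ` middle_thirds_stage n"

definition middle_thirds_Cantor_set :: "real set" where
  "middle_thirds_Cantor_set = (\<Inter>n. middle_thirds_stage n)"

definition is_Cantor_set :: "'a::topological_space set \<Rightarrow> bool" where
  "is_Cantor_set S \<longleftrightarrow> S homeomorphic middle_thirds_Cantor_set"

definition theta_root :: "nat \<Rightarrow> real \<Rightarrow> bool" where
  "theta_root d x \<longleftrightarrow> x \<ge> 0 \<and> real d * x ^ (d - 1) + (real d - 1) * x ^ d - 1 = 0"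

definition theta :: "nat \<Rightarrow> real" where
  "theta d = (THE x. theta_root d x)"

definition vartheta :: "nat \<Rightarrow> real" where
  "vartheta d = real d * theta d ^ (d - 1)"

end

theory Submission
  imports Defs "HOL-Complex_Analysis.Complex_Analysis"
begin

text \<open>Put \<open>g z = ((z - (1 - p)) / p) ^ d\<close>, with filled Julia set \<open>K\<close>; then \<open>E\<close> is the preimage of \<open>K\<close>
  under the first map, whose only critical value is \<open>0\<close>, as for \<open>g\<close>. Each map pushes points outside
  the closed unit disc \<open>D\<close> further out, so \<open>E\<close> is the decreasing intersection of the preimages of \<open>D\<close>.

  If \<open>0 \<in> K\<close>, all these preimages are connected, because the preimage of a connected set containing
  the critical value is connected.

  Otherwise the whole half-line of real \<open>x \<le> 0\<close> escapes, and all branches of the inverse of \<open>g\<close> are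
  holomorphic, non-surjective self-maps of a slit disc \<open>U\<close> containing \<open>K\<close>, so they strictly contract
  the pseudo-hyperbolic distance of \<open>U\<close>. Among the pairs of points of \<open>K\<close> with equal itineraries one at
  maximal distance exists by compactness; applying \<open>g\<close> would increase the distance, so the itinerary
  separates points. Hence \<open>E\<close> is compact, perfect and separated by countably many clopen sets, and such
  a space is a Cantor set by Brouwer's argument.

  Whether \<open>0\<close> escapes is a question about the real map \<open>g\<close>. For odd \<open>d\<close> this map is increasing, and
  \<open>- (t ^ d)\<close> is mapped to the left of itself iff \<open>p < (t ^ d + 1) / (t + 1)\<close>, a quantity whose minimum
  over \<open>t \<ge> 0\<close> is \<open>vartheta d\<close>, attained at \<open>theta d\<close>.\<close>

section \<open>Cantor sets\<close>

text \<open>The sets \<open>B i\<close> are relatively clopen in \<open>X\<close>, so finite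
  agreement describes a neighbourhood and \<open>perfect\<close> excludes isolated points.\<close>

locale Cantor_separation =
  fixes X :: "'a::t2_space set" and B :: "nat \<Rightarrow> 'a set"
  assumes compact: "compact X"
    and nonempty: "X \<noteq> {}"
    and closed_inside: "\<And>i. closed (X \<inter> B i)"
    and closed_outside: "\<And>i. closed (X - B i)"
    and separating: "\<And>x y. \<lbrakk>x \<in> X; y \<in> X; \<And>i. x \<in> B i \<longleftrightarrow> y \<in> B i\<rbrakk> \<Longrightarrow> x = y"
    and perfect: "\<And>x n. x \<in> X \<Longrightarrow> \<exists>y\<in>X. y \<noteq> x \<and> (\<forall>i<n. y \<in> B i \<longleftrightarrow> x \<in> B i)"
begin

text \<open>Each cell is split at its own first separating index rather than at a prescribed one.
  Both halves are then nonempty, so every binary sequence occurs as a code.\<close>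

definition cut :: "'a set \<Rightarrow> nat" where
  "cut A = (LEAST k. \<exists>x\<in>A. \<exists>y\<in>A. x \<in> B k \<and> y \<notin> B k)"

definition half :: "'a set \<Rightarrow> bool \<Rightarrow> 'a set" where
  "half A b = (if b then A \<inter> B (cut A) else A - B (cut A))"

primrec cell :: "(nat \<Rightarrow> real) \<Rightarrow> nat \<Rightarrow> 'a set" where
  "cell s 0 = X"
| "cell s (Suc m) = half (cell s m) (s m = 1)"

primrec cell_of :: "'a \<Rightarrow> nat \<Rightarrow> 'a set" where
  "cell_of x 0 = X"
| "cell_of x (Suc m) = half (cell_of x m) (x \<in> B (cut (cell_of x m)))"

text \<open>Real values, rather than booleans, because a function type into a metric space is an
  instance of the Hausdorff class.\<close>

definition code :: "'a \<Rightarrow> nat \<Rightarrow> real" where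
  "code x m = of_bool (x \<in> B (cut (cell_of x m)))"

lemma cell_code: "cell (code x) m = cell_of x m"
  by (induction m) (auto simp: code_def)

lemma cell_subset: "cell s m \<subseteq> X"
  by (induction m) (auto simp: half_def)

lemma cell_antimono: "m \<le> n \<Longrightarrow> cell s n \<subseteq> cell s m"
  by (rule lift_Suc_antimono_le[of "cell s"]) (auto simp: half_def)

lemma mem_cell_of: "x \<in> X \<Longrightarrow> x \<in> cell_of x m"
  by (induction m) (auto simp: half_def)

lemma cell_of_eq: "y \<in> cell_of x m \<Longrightarrow> cell_of y m = cell_of x m"
proof (induction m)
  case (Suc m)
  then have "y \<in> cell_of x m" and "cell_of y m = cell_of x m"
    by (auto simp: half_def split: if_splits)
  with Suc.prems show ?case
    by (auto simp: half_def)
qed simp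

lemma ex_cut:
  assumes "A \<subseteq> X" "x \<in> A" "y \<in> A" "x \<noteq> y"
  shows "\<exists>x\<in>A. \<exists>y\<in>A. x \<in> B (cut A) \<and> y \<notin> B (cut A)"
proof -
  obtain i where "(x \<in> B i) \<noteq> (y \<in> B i)"
    using separating assms by (metis subsetD)
  then have "\<exists>x\<in>A. \<exists>y\<in>A. x \<in> B i \<and> y \<notin> B i"
    using assms by blast
  then show ?thesis
    unfolding cut_def by (rule LeastI)
qed

lemma agree_below_cut:
  assumes "i < cut A" "x \<in> A" "y \<in> A"
  shows "x \<in> B i \<longleftrightarrow> y \<in> B i"
  using not_less_Least[OF assms(1)[unfolded cut_def]] assms(2,3) by blast

text \<open>Together with perfectness this gives every nonempty cell a second point.\<close>

lemma cell_determined: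
  "\<exists>N. \<forall>x\<in>cell s m. \<forall>y\<in>X. (\<forall>i<N. y \<in> B i \<longleftrightarrow> x \<in> B i) \<longrightarrow> y \<in> cell s m"
proof (induction m)
  case (Suc m)
  then obtain N where N: "\<forall>x\<in>cell s m. \<forall>y\<in>X. (\<forall>i<N. y \<in> B i \<longleftrightarrow> x \<in> B i) \<longrightarrow> y \<in> cell s m"
    by blast
  let ?M = "max N (Suc (cut (cell s m)))"
  have "y \<in> cell s (Suc m)"
    if "x \<in> cell s (Suc m)" "y \<in> X" "\<forall>i<?M. y \<in> B i \<longleftrightarrow> x \<in> B i" for x y
  proof -
    have "x \<in> cell s m"
      using that(1) by (auto simp: half_def split: if_splits)
    then have "y \<in> cell s m" "y \<in> B (cut (cell s m)) \<longleftrightarrow> x \<in> B (cut (cell s m))"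
      using N that(2,3) by auto
    with that(1) show ?thesis
      by (auto simp: half_def)
  qed
  then show ?case by blast
qed auto

lemma cell_splits:
  assumes "cell s m \<noteq> {}"
  shows "\<exists>x\<in>cell s m. \<exists>y\<in>cell s m. x \<in> B (cut (cell s m)) \<and> y \<notin> B (cut (cell s m))"
proof -
  obtain x where x: "x \<in> cell s m" using assms by blast
  obtain N where N: "\<forall>x\<in>cell s m. \<forall>y\<in>X. (\<forall>i<N. y \<in> B i \<longleftrightarrow> x \<in> B i) \<longrightarrow> y \<in> cell s m"
    using cell_determined by blast
  obtain y where "y \<in> X" "y \<noteq> x" "\<forall>i<N. y \<in> B i \<longleftrightarrow> x \<in> B i"
    using perfect x cell_subset by blast
  then show ?thesis
    using ex_cut[OF cell_subset x] N x by metis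
qed

lemma cell_nonempty: "cell s m \<noteq> {}"
proof (induction m)
  case (Suc m)
  then show ?case
    using cell_splits[OF Suc] by (auto simp: half_def)
qed (simp add: nonempty)

lemma closed_cell: "closed (cell s m)"
proof (induction m)
  case 0
  then show ?case using compact compact_imp_closed by simp
next
  case (Suc m)
  have "half (cell s m) b = cell s m \<inter> (if b then X \<inter> B (cut (cell s m)) else X - B (cut (cell s m)))" for b
    using cell_subset[of s m] by (auto simp: half_def)
  then show ?case
    using Suc closed_inside closed_outside by (auto intro: closed_Int)
qed

text \<open>On a half, membership is constant in every \<open>B k\<close> up to and including the
  index of the cut, so cuts strictly increase along a branch. Cells of depth \<open>Suc i\<close>
  therefore decide membership in \<open>B i\<close>, which makes \<open>code\<close>
  injective.\<close>

lemma cut_ge: "m \<le> cut (cell s m)"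
proof (induction m)
  case (Suc m)
  let ?k = "cut (cell s m)"
  have same: "x \<in> B i \<longleftrightarrow> y \<in> B i"
    if "x \<in> cell s (Suc m)" "y \<in> cell s (Suc m)" "i \<le> ?k" for x y i
  proof (cases "i = ?k")
    case True
    then show ?thesis using that by (auto simp: half_def split: if_splits)
  next
    case False
    then show ?thesis
      using that agree_below_cut[of i "cell s m" x y] cell_antimono[of m "Suc m" s] by auto
  qed
  have "\<not> cut (cell s (Suc m)) \<le> ?k"
    using cell_splits[OF cell_nonempty, of s "Suc m"] same by blast
  with Suc show ?case by simp
qed simp

lemma inj_on_code: "inj_on code X"
proof (rule inj_onI)
  fix x y assume xy: "x \<in> X" "y \<in> X" "code x = code y"
  show "x = y"
  proof (rule separating[OF xy(1,2)])
    fix i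
    have "i < cut (cell (code x) (Suc i))"
      using cut_ge[of "Suc i" "code x"] by simp
    moreover have "x \<in> cell (code x) (Suc i)" "y \<in> cell (code x) (Suc i)"
      using mem_cell_of xy cell_code by metis+
    ultimately show "x \<in> B i \<longleftrightarrow> y \<in> B i"
      by (rule agree_below_cut)
  qed
qed

text \<open>The cells along \<open>s\<close> are nested, nonempty and closed, so by compactness they
  share a point. That point makes exactly the choices prescribed by \<open>s\<close>.\<close>

lemma code_image: "code ` X = {s. \<forall>n. s n \<in> {0, 1}}"
proof
  show "{s. \<forall>n. s n \<in> {0, 1}} \<subseteq> code ` X"
  proof
    fix s :: "nat \<Rightarrow> real" assume "s \<in> {s. \<forall>n. s n \<in> {0, 1}}"
    then have s: "s n = of_bool (s n = 1)" for n
      by (cases "s n = 1") auto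
    have "X \<inter> \<Inter> (cell s ` UNIV) \<noteq> {}"
    proof (rule compact_imp_fip_image[OF compact closed_cell])
      fix I :: "nat set" assume "finite I"
      then have "cell s (Max (insert 0 I)) \<subseteq> cell s i" if "i \<in> I" for i
        using that by (intro cell_antimono Max_ge) auto
      then have "cell s (Max (insert 0 I)) \<subseteq> X \<inter> \<Inter> (cell s ` I)"
        using cell_subset by (intro Int_greatest INT_greatest)
      then show "X \<inter> \<Inter> (cell s ` I) \<noteq> {}"
        using cell_nonempty by blast
    qed
    then obtain x where x: "x \<in> X" "\<And>m. x \<in> cell s m" by blast
    have eq: "cell_of x m = cell s m" for m
    proof (induction m)
      case (Suc m)
      then show ?case using x(2)[of "Suc m"] by (auto simp: half_def split: if_splits)
    qed simp
    have "code x m = s m" for m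
      using x(2)[of "Suc m"] by (subst s) (auto simp: code_def eq half_def split: if_splits)
    then have "s = code x" by (simp add: fun_eq_iff)
    then show "s \<in> code ` X" using x(1) by blast
  qed
qed (auto simp: code_def)

lemma openin_cell: "openin (top_of_set X) (cell s m)"
proof (induction m)
  case (Suc m)
  have closedin: "closedin (top_of_set X) (X - B i)" "closedin (top_of_set X) (X \<inter> B i)" for i
    using closed_inside closed_outside by (auto intro: closed_subset)
  have "half (cell s m) b
      = cell s m - (if b then X - B (cut (cell s m)) else X \<inter> B (cut (cell s m)))" for b
    using cell_subset[of s m] by (auto simp: half_def)
  then show ?case
    using Suc closedin by (simp add: openin_diff)
qed simp

text \<open>Coordinate \<open>m\<close> is constant on the cells of depth \<open>Suc m\<close>,
  which are relatively open.\<close>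

lemma continuous_on_code: "continuous_on X code"
proof (rule continuous_on_coordinatewise_then_product)
  fix m
  show "continuous_on X (\<lambda>x. code x m)"
    unfolding continuous_on_topological
  proof (intro ballI allI impI)
    fix x V assume x: "x \<in> X" and V: "code x m \<in> V"
    obtain U where U: "open U" "cell_of x (Suc m) = X \<inter> U"
      using openin_cell[of "code x" "Suc m"] by (metis cell_code openin_open)
    have "code y m \<in> V" if "y \<in> X" "y \<in> U" for y
    proof -
      have y: "y \<in> cell_of x (Suc m)" using that U by blast
      then have "y \<in> cell_of x m" by (auto simp: half_def split: if_splits)
      then have "code y m = code x m"
        using y cell_of_eq by (auto simp: code_def half_def split: if_splits)
      then show ?thesis using V by simp
    qed
    moreover have "x \<in> U"
      using mem_cell_of[OF x, of "Suc m"] U(2) by blast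
    ultimately show "\<exists>U. open U \<and> x \<in> U \<and> (\<forall>y\<in>X. y \<in> U \<longrightarrow> code y m \<in> V)"
      using U(1) by blast
  qed
qed

theorem homeomorphic_binary_sequences: "X homeomorphic {s :: nat \<Rightarrow> real. \<forall>n. s n \<in> {0, 1}}"
  using homeomorphic_compact[OF compact continuous_on_code code_image inj_on_code] .

end

text \<open>The expanding map of the Cantor set: \<open>3 x\<close> on the left third and \<open>3 x - 2\<close> on the right third,
  interpolated so as to be continuous on the whole line.\<close>

definition tripling :: "real \<Rightarrow> real" where
  "tripling x = 3 * x - max 0 (min 2 (6 * x - 2))"

lemma tripling_low [simp]: "x \<le> 1 / 3 \<Longrightarrow> tripling x = 3 * x"
  and tripling_high [simp]: "2 / 3 \<le> x \<Longrightarrow> tripling x = 3 * x - 2"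
  by (auto simp: tripling_def)

section \<open>The middle-thirds set and its expanding map\<close>

lemma middle_thirds_stage_subset: "middle_thirds_stage n \<subseteq> {0..1}"
  by (induction n) (auto simp: subset_iff)

lemma compact_middle_thirds_stage: "compact (middle_thirds_stage n)"
proof (induction n)
  case (Suc n)
  then show ?case
    by (auto intro!: compact_Un compact_continuous_image continuous_intros)
qed simp

lemma compact_middle_thirds: "compact middle_thirds_Cantor_set"
  unfolding middle_thirds_Cantor_set_def
  by (intro compact_Inter) (auto simp: compact_middle_thirds_stage)

lemma middle_thirds_cases:
  assumes "x \<in> middle_thirds_Cantor_set"
  obtains "0 \<le> x" "x \<le> 1 / 3" | "2 / 3 \<le> x" "x \<le> 1"
proof -
  have "x \<in> middle_thirds_stage (Suc 0)"
    using assms by (auto simp: middle_thirds_Cantor_set_def simp del: middle_thirds_stage.simps)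
  then show ?thesis using that by auto
qed

lemma tripling_middle_thirds:
  assumes "x \<in> middle_thirds_Cantor_set"
  shows "tripling x \<in> middle_thirds_Cantor_set"
proof -
  have "tripling x \<in> middle_thirds_stage n" for n
  proof -
    have "x \<in> middle_thirds_stage (Suc n)"
      using assms unfolding middle_thirds_Cantor_set_def by blast
    then obtain y where y: "y \<in> middle_thirds_stage n" "x = y / 3 \<or> x = 2 / 3 + y / 3"
      by auto
    moreover have "0 \<le> y" "y \<le> 1"
      using y(1) middle_thirds_stage_subset by (force simp: subset_iff)+
    ultimately have "tripling x = y" by auto
    with y(1) show ?thesis by simp
  qed
  then show ?thesis by (simp add: middle_thirds_Cantor_set_def)
qed

lemma funpow_tripling_middle_thirds:
  "x \<in> middle_thirds_Cantor_set \<Longrightarrow> (tripling ^^ n) x \<in> middle_thirds_Cantor_set"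
  by (induction n) (auto simp: tripling_middle_thirds)

lemma middle_thirds_contractions:
  assumes "x \<in> middle_thirds_Cantor_set"
  shows "x / 3 \<in> middle_thirds_Cantor_set" "2 / 3 + x / 3 \<in> middle_thirds_Cantor_set"
proof -
  have x: "x \<in> middle_thirds_stage n" for n
    using assms by (auto simp: middle_thirds_Cantor_set_def)
  have "x / 3 \<in> middle_thirds_stage n \<and> 2 / 3 + x / 3 \<in> middle_thirds_stage n" for n
    using x[of 0] x[of "n - 1"] by (cases n) auto
  then show "x / 3 \<in> middle_thirds_Cantor_set" "2 / 3 + x / 3 \<in> middle_thirds_Cantor_set"
    by (simp_all add: middle_thirds_Cantor_set_def)
qed

lemma zero_one_middle_thirds: "0 \<in> middle_thirds_Cantor_set" "1 \<in> middle_thirds_Cantor_set"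
proof -
  have "0 \<in> middle_thirds_stage n \<and> 1 \<in> middle_thirds_stage n" for n
    by (induction n) (auto simp: image_iff intro: bexI[of _ 1] bexI[of _ 0])
  then show "0 \<in> middle_thirds_Cantor_set" "1 \<in> middle_thirds_Cantor_set"
    by (simp_all add: middle_thirds_Cantor_set_def)
qed

text \<open>The sets read off ternary digits. Equal digits let the distance triple at every step,
  which boundedness forbids for distinct points; other points with the same first digits come from
  pulling back along the two contractions.\<close>

lemma Cantor_separation_middle_thirds:
  "Cantor_separation middle_thirds_Cantor_set (\<lambda>n. {x. (tripling ^^ n) x \<ge> 1 / 2})"
    (is "Cantor_separation ?C ?B")
proof
  have cont: "continuous_on UNIV (tripling ^^ n)" for n
  proof (induction n)
    case (Suc n)
    have "continuous_on UNIV tripling"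
      unfolding tripling_def by (intro continuous_intros)
    with Suc show ?case
      using continuous_on_compose[of UNIV "tripling ^^ n" tripling]
      by (auto intro: continuous_on_subset)
  qed simp
  \<comment> \<open>The orbit avoids the open middle third, so the negation of the test at
    \<open>1 / 2\<close> is a closed condition too.\<close>
  have half: "(tripling ^^ n) x \<ge> 1 / 2 \<longleftrightarrow> \<not> (tripling ^^ n) x \<le> 1 / 3" if "x \<in> ?C" for x n
    using funpow_tripling_middle_thirds[OF that, of n] by (cases rule: middle_thirds_cases) auto
  have closed_C: "closed ?C"
    using compact_middle_thirds compact_imp_closed by blast
  show "closed (?C \<inter> ?B n)" for n
    by (intro closed_Int closed_C closed_Collect_le cont continuous_intros)
  show "closed (?C - ?B n)" for n
  proof -
    have "?C - ?B n = ?C \<inter> {x. (tripling ^^ n) x \<le> 1 / 3}"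
      using half[of _ n] by auto
    then show ?thesis
      by (auto intro!: closed_Int closed_C closed_Collect_le cont continuous_intros)
  qed
  show "x = y" if xy: "x \<in> ?C" "y \<in> ?C" "\<And>n. x \<in> ?B n \<longleftrightarrow> y \<in> ?B n" for x y
  proof (rule ccontr)
    assume "x \<noteq> y"
    have expand: "\<bar>(tripling ^^ n) x - (tripling ^^ n) y\<bar> = 3 ^ n * \<bar>x - y\<bar>" for n
    proof (induction n)
      case (Suc n)
      have "\<bar>tripling u - tripling v\<bar> = 3 * \<bar>u - v\<bar>"
        if "u \<in> ?C" "v \<in> ?C" "u \<ge> 1 / 2 \<longleftrightarrow> v \<ge> 1 / 2" for u v
      proof -
        have "tripling u - tripling v = 3 * (u - v)"
          using that(1) that(2,3)
          by (cases rule: middle_thirds_cases; cases rule: middle_thirds_cases[OF that(2)]) auto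
        then show ?thesis by (simp only: abs_mult abs_numeral)
      qed
      from this[OF funpow_tripling_middle_thirds funpow_tripling_middle_thirds, OF xy(1,2), of n n]
      show ?case using Suc xy(3)[of n] by simp
    qed simp
    have "3 ^ n * \<bar>x - y\<bar> \<le> 1" for n
      using funpow_tripling_middle_thirds[OF xy(1), of n] funpow_tripling_middle_thirds[OF xy(2), of n]
      by (subst expand[symmetric]) (auto elim!: middle_thirds_cases)
    moreover obtain n where "1 / \<bar>x - y\<bar> < 3 ^ n"
      using real_arch_pow[of 3 "1 / \<bar>x - y\<bar>"] by auto
    ultimately show False
      using \<open>x \<noteq> y\<close> by (simp add: divide_less_eq leD)
  qed
  show "\<exists>y\<in>?C. y \<noteq> x \<and> (\<forall>i<n. y \<in> ?B i \<longleftrightarrow> x \<in> ?B i)" if "x \<in> ?C" for x n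
    using that
  proof (induction n arbitrary: x)
    case 0
    then show ?case
      using zero_one_middle_thirds by (cases "x = 0") auto
  next
    case (Suc n)
    obtain y where y: "y \<in> ?C" "y \<noteq> tripling x" "\<forall>i<n. y \<in> ?B i \<longleftrightarrow> tripling x \<in> ?B i"
      using Suc.IH[OF tripling_middle_thirds[OF Suc.prems]] by blast
    \<comment> \<open>The preimage of \<open>y\<close> in the third containing \<open>x\<close>
      keeps the first digit of \<open>x\<close>; its further digits are those of
      \<open>y\<close>.\<close>
    define z where "z = (if x \<le> 1 / 3 then y / 3 else 2 / 3 + y / 3)"
    have "0 \<le> y" "y \<le> 1"
      using y(1) by (auto elim: middle_thirds_cases)
    then have z: "tripling z = y" "z \<in> ?C" "z \<in> ?B 0 \<longleftrightarrow> x \<in> ?B 0"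
      using Suc.prems middle_thirds_contractions[OF y(1)]
      by (auto simp: z_def elim!: middle_thirds_cases)
    have "z \<in> ?B i \<longleftrightarrow> x \<in> ?B i" if "i < Suc n" for i
    proof (cases i)
      case (Suc j)
      then show ?thesis
        using y(3) that z(1) by (simp add: funpow_swap1)
    qed (use z in simp)
    moreover have "z \<noteq> x"
      using z(1) y(2) by auto
    ultimately show ?case
      using z(2) by blast
  qed
qed (use compact_middle_thirds zero_one_middle_thirds in blast)+

text \<open>The binary sequences are a common model for \<open>X\<close> and for the middle-thirds
  set.\<close>

theorem (in Cantor_separation) is_Cantor_set: "is_Cantor_set X"
  unfolding is_Cantor_set_def
  using homeomorphic_binary_sequences
    Cantor_separation.homeomorphic_binary_sequences[OF Cantor_separation_middle_thirds]
  by (metis homeomorphic_sym homeomorphic_trans)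

text \<open>Makes the two alternatives for \<open>E\<close> exclusive: the model contains 0 and 1
  but misses \<open>1 / 2\<close>.\<close>

lemma is_Cantor_set_imp_not_connected:
  assumes "is_Cantor_set S"
  shows "\<not> connected S"
proof -
  have "1 / 2 \<notin> middle_thirds_Cantor_set"
    by (auto elim: middle_thirds_cases)
  then have "\<not> connected middle_thirds_Cantor_set"
    using connectedD_interval[OF _ zero_one_middle_thirds, of "1 / 2"] by auto
  then show ?thesis
    using assms homeomorphic_connectedness unfolding is_Cantor_set_def by blast
qed

section \<open>Dynamics of affine powers\<close>

text \<open>A nonempty clopen part of the preimage has a clopen image, by openness of the map and by
  compactness. It is therefore mapped onto \<open>S\<close> and contains \<open>a\<close>, the only
  point over \<open>b\<close>; two complementary parts cannot both do so.\<close>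

lemma connected_vimage_of_singleton_fibre:
  fixes f :: "'a::t2_space \<Rightarrow> 'b::t2_space"
  assumes cont: "continuous_on (f -` S) f" and comp: "compact (f -` S)"
    and open_map: "\<And>U. open U \<Longrightarrow> open (f ` U)"
    and S: "connected S" "b \<in> S" and fibre: "f -` {b} \<subseteq> {a}"
  shows "connected (f -` S)"
proof -
  have hits: "a \<in> T"
    if T: "openin (top_of_set (f -` S)) T" "closedin (top_of_set (f -` S)) T" "T \<noteq> {}" for T
  proof -
    obtain U where U: "open U" "T = f -` S \<inter> U"
      using T(1) by (auto simp: openin_open)
    have "f ` T = S \<inter> f ` U"
      using U by auto
    then have "openin (top_of_set S) (f ` T)"
      using open_map[OF U(1)] by (simp add: openin_open_Int)
    moreover have "compact (f ` T)"
      using comp cont T(2) closedin_compact closedin_imp_subset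
      by (metis compact_continuous_image continuous_on_subset)
    then have "closedin (top_of_set S) (f ` T)"
      using \<open>f ` T = S \<inter> f ` U\<close> by (simp add: closed_subset compact_imp_closed)
    ultimately have "f ` T = S"
      using S(1) T(3) by (auto simp: connected_clopen)
    then show ?thesis
      using S(2) fibre by auto
  qed
  show ?thesis
    unfolding connected_clopen
  proof (intro allI impI)
    fix T assume T: "openin (top_of_set (f -` S)) T \<and> closedin (top_of_set (f -` S)) T"
    have "f -` S - T \<noteq> {} \<Longrightarrow> a \<in> f -` S - T"
      using T by (intro hits) auto
    moreover have "T \<noteq> {} \<Longrightarrow> a \<in> T"
      using T hits by blast
    ultimately show "T = {} \<or> T = f -` S"
      using T closedin_imp_subset by fastforce
  qed
qed

section \<open>Affine powers and escape from the unit disc\<close>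

definition affine_power :: "nat \<Rightarrow> real \<Rightarrow> complex \<Rightarrow> complex" where
  "affine_power d q z = ((z - (1 - of_real q)) / of_real q) ^ d"

lemma step_map_eq: "step_map d ps j = affine_power d (ps j)"
  by (simp add: fun_eq_iff step_map_def affine_power_def)

lemma continuous_on_affine_power [continuous_intros]:
  assumes "0 < q" "continuous_on A f"
  shows "continuous_on A (\<lambda>z. affine_power d q (f z))"
  unfolding affine_power_def using assms by (auto intro!: continuous_intros)

lemma norm_affine_power_ge:
  assumes "0 < q" "q \<le> 1" "1 \<le> cmod z"
  shows "cmod z ^ d \<le> cmod (affine_power d q z)"
proof -
  have "cmod z - (1 - q) \<le> cmod (z - (1 - of_real q))"
    using norm_triangle_ineq2[of z "of_real (1 - q)"] assms(2)
    unfolding norm_of_real by simp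
  moreover have "q * cmod z \<le> cmod z - (1 - q)"
    using mult_nonneg_nonneg[of "1 - q" "cmod z - 1"] assms by (simp add: algebra_simps)
  ultimately have "cmod z \<le> cmod (z - (1 - of_real q)) / q"
    using assms(1) by (simp add: pos_le_divide_eq mult.commute)
  then show ?thesis
    using assms(1) by (simp add: affine_power_def norm_power norm_divide power_mono)
qed

text \<open>The square lies above its tangent at 1. The excess of the modulus over 1 thus at least
  doubles, uniformly in \<open>q\<close>, and an orbit that has left the closed disc tends to
  infinity.\<close>

lemma norm_affine_power_escape:
  assumes "2 \<le> d" "0 < q" "q \<le> 1" "1 \<le> cmod z"
  shows "1 + 2 * (cmod z - 1) \<le> cmod (affine_power d q z)"
proof -
  have "1 + 2 * (cmod z - 1) \<le> cmod z ^ 2"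
    using sum_squares_ge_zero[of "cmod z - 1" 0] by (simp add: power2_eq_square algebra_simps)
  also have "\<dots> \<le> cmod z ^ d"
    using assms by (intro power_increasing) auto
  finally show ?thesis
    using norm_affine_power_ge[OF assms(2,3,4), of d] by simp
qed

lemma norm_affine_power_le_one_imp:
  assumes "2 \<le> d" "0 < q" "q \<le> 1" "cmod (affine_power d q z) \<le> 1"
  shows "cmod z \<le> 1"
proof (rule ccontr)
  assume "\<not> cmod z \<le> 1"
  then show False
    using norm_affine_power_escape[OF assms(1-3), of z] assms(4) by simp
qed

lemma open_affine_power_image:
  assumes "0 < d" "0 < q" "open U"
  shows "open (affine_power d q ` U)"
proof (rule open_mapping_thm[of _ UNIV])
  show "affine_power d q holomorphic_on UNIV"
    unfolding affine_power_def using assms(2) by (intro holomorphic_intros) auto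
  have "affine_power d q (1 - of_real q) \<noteq> affine_power d q 1"
    using assms by (simp add: affine_power_def power_0_left)
  then show "\<not> affine_power d q constant_on UNIV"
    unfolding constant_on_def by (metis UNIV_I)
qed (use assms in auto)

lemma affine_power_eq_0_iff: "0 < d \<Longrightarrow> 0 < q \<Longrightarrow> affine_power d q z = 0 \<longleftrightarrow> z = 1 - of_real q"
  by (auto simp: affine_power_def)

text \<open>Preimages of subsets of the closed disc stay in it, which gives compactness. The fibre
  over the critical value 0 is a single point, which gives connectedness.\<close>

lemma connected_vimage_affine_power:
  assumes "2 \<le> d" "0 < q" "q \<le> 1" "closed S" "S \<subseteq> cball 0 1" "connected S" "0 \<in> S"
  shows "compact (affine_power d q -` S)" "connected (affine_power d q -` S)"
proof -
  have sub: "affine_power d q -` S \<subseteq> cball 0 1"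
    using norm_affine_power_le_one_imp[OF assms(1-3)] assms(5) by auto
  have cont: "continuous_on A (affine_power d q)" for A
    using assms(2) continuous_on_affine_power[of q A "\<lambda>z. z"] by auto
  have "closed (affine_power d q -` S)"
    using cont assms(4) by (intro closed_vimage) auto
  then show comp: "compact (affine_power d q -` S)"
    using bounded_subset[OF bounded_cball sub] by (simp add: compact_eq_bounded_closed)
  show "connected (affine_power d q -` S)"
  proof (rule connected_vimage_of_singleton_fibre[OF cont comp _ assms(6,7)])
    show "affine_power d q -` {0} \<subseteq> {1 - of_real q}"
      using assms(1,2) by (auto simp: affine_power_eq_0_iff)
  qed (use open_affine_power_image assms in auto)
qed

definition filled_Julia :: "nat \<Rightarrow> real \<Rightarrow> complex set" where
  "filled_Julia d q = {w. \<forall>n. cmod ((affine_power d q ^^ n) w) \<le> 1}"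

lemma bounded_orbit_set_eq:
  assumes d: "2 \<le> d" and ps: "\<And>j. 0 < ps (Suc j)" "\<And>j. ps (Suc j) \<le> 1"
  shows "bounded_orbit_set d ps = {z. \<forall>j. cmod (iter_map d ps j z) \<le> 1}"
proof (intro equalityI subsetI CollectI allI)
  fix z j assume "z \<in> bounded_orbit_set d ps"
  then obtain N where "limsup (\<lambda>j. ereal (cmod (iter_map d ps j z))) < ereal (real N)"
    by (auto simp: bounded_orbit_set_def less_PInf_Ex_of_nat)
  then obtain m where m: "\<And>j. j \<ge> m \<Longrightarrow> cmod (iter_map d ps j z) < N"
    using Limsup_lessD by (fastforce simp: eventually_sequentially)
  show "cmod (iter_map d ps j z) \<le> 1"
  proof (rule ccontr)
    assume escaped: "\<not> ?thesis"
    define e where "e = cmod (iter_map d ps j z) - 1"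
    have e: "e > 0" using escaped by (simp add: e_def)
    have grow: "2 ^ k * e \<le> cmod (iter_map d ps (j + k) z) - 1" for k
    proof (induction k)
      case (Suc k)
      have "0 \<le> 2 ^ k * e" using e by simp
      then have "1 \<le> cmod (iter_map d ps (j + k) z)"
        using Suc by linarith
      then have "2 * (cmod (iter_map d ps (j + k) z) - 1) \<le> cmod (iter_map d ps (j + Suc k) z) - 1"
        using norm_affine_power_escape[OF d ps, of "iter_map d ps (j + k) z" "j + k"]
        by (simp add: step_map_eq)
      then show ?case using Suc by simp
    qed (simp add: e_def)
    obtain k where "N / e < 2 ^ k"
      using real_arch_pow[of 2 "N / e"] by auto
    \<comment> \<open>Adding \<open>m\<close> to the exponent moves the time past the point from
      which the bound \<open>N\<close> holds.\<close>
    also have "(2::real) ^ k \<le> 2 ^ (k + m)"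
      by (intro power_increasing) auto
    finally have "N < 2 ^ (k + m) * e"
      using e by (simp add: divide_less_eq)
    then show False
      using grow[of "k + m"] m[of "j + (k + m)"] by simp
  qed
next
  fix z assume "z \<in> {z. \<forall>j. cmod (iter_map d ps j z) \<le> 1}"
  then have "limsup (\<lambda>j. ereal (cmod (iter_map d ps j z))) \<le> 1"
    by (intro Limsup_bounded) auto
  then show "z \<in> bounded_orbit_set d ps"
    by (auto simp: bounded_orbit_set_def)
qed

locale eventually_constant =
  fixes d :: nat and p :: real and ps :: "nat \<Rightarrow> real"
  assumes d: "2 \<le> d" and p: "0 < p" "p < 1" and ps1: "0 < ps 1" "ps 1 \<le> 1"
    and ps: "\<And>j. 2 \<le> j \<Longrightarrow> ps j = p"
begin

abbreviation "g \<equiv> affine_power d p"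
abbreviation "K \<equiv> filled_Julia d p"
abbreviation "E \<equiv> bounded_orbit_set d ps"

lemma ps_bounds: "0 < ps (Suc j)" "ps (Suc j) \<le> 1"
proof -
  have "0 < ps (Suc j) \<and> ps (Suc j) \<le> 1"
  proof (cases j)
    case 0
    then show ?thesis using ps1 by simp
  next
    case (Suc i)
    then have "ps (Suc j) = p" by (intro ps) simp
    then show ?thesis using p by simp
  qed
  then show "0 < ps (Suc j)" "ps (Suc j) \<le> 1" by blast+
qed

lemma iter_map_Suc: "iter_map d ps (Suc n) z = (g ^^ n) (affine_power d (ps 1) z)"
  by (induction n) (auto simp: step_map_eq ps)

lemma E_eq: "E = {z. \<forall>j. cmod (iter_map d ps j z) \<le> 1}"
  using bounded_orbit_set_eq[of d ps] d ps_bounds by simp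

lemma norm_iter_map_antimono:
  "cmod (iter_map d ps (Suc n) z) \<le> 1 \<Longrightarrow> cmod (iter_map d ps n z) \<le> 1"
  using norm_affine_power_le_one_imp[OF d ps_bounds] by (simp add: step_map_eq)

lemma norm_iter_map_le_one_mono:
  "cmod (iter_map d ps n z) \<le> 1 \<Longrightarrow> m \<le> n \<Longrightarrow> cmod (iter_map d ps m z) \<le> 1"
proof (induction n)
  case (Suc n)
  then show ?case
    using norm_iter_map_antimono[of n z] by (cases "m = Suc n") (auto simp del: iter_map.simps)
qed simp

text \<open>From index \<open>Suc n\<close> on only \<open>g\<close> is applied, and a point of the
  orbit in the closed disc forces all earlier ones into it, so a tail decides membership.\<close>

lemma iter_map_mem_K_iff: "iter_map d ps (Suc n) z \<in> K \<longleftrightarrow> z \<in> E"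
proof -
  have shift: "(g ^^ m) (iter_map d ps (Suc n) z) = iter_map d ps (Suc n + m) z" for m
    by (induction m) (auto simp: step_map_eq ps)
  have "cmod (iter_map d ps j z) \<le> 1" if "\<forall>m. cmod (iter_map d ps (Suc n + m) z) \<le> 1" for j
  proof -
    have "cmod (iter_map d ps (Suc n + j) z) \<le> 1" using that by blast
    moreover have "j \<le> Suc n + j" by simp
    ultimately show ?thesis
      by (rule norm_iter_map_le_one_mono)
  qed
  then show ?thesis
    unfolding E_eq filled_Julia_def mem_Collect_eq shift by blast
qed

text \<open>The critical value 0 belongs to every \<open>L n\<close>, so connectedness survives each
  pullback. It passes to \<open>E\<close> because decreasing intersections of compact connected sets
  are connected.\<close>

lemma connected_E:
  assumes "0 \<in> K"
  shows "connected E"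
proof -
  define L where "L n = {w. cmod ((g ^^ n) w) \<le> 1}" for n
  have L_Suc: "L (Suc n) = g -` L n" for n
    by (auto simp: L_def funpow_Suc_right simp del: funpow.simps)
  have L0: "0 \<in> L n" for n
    using assms by (auto simp: L_def filled_Julia_def)
  have L: "compact (L n) \<and> connected (L n) \<and> L n \<subseteq> cball 0 1" for n
  proof (induction n)
    case 0
    have "L 0 = cball 0 1" by (auto simp: L_def)
    then show ?case by simp
  next
    case (Suc n)
    then show ?case
      unfolding L_Suc
      using connected_vimage_affine_power[OF d p(1), of "L n"] p L0 compact_imp_closed
        norm_affine_power_le_one_imp[OF d p(1)]
      by (auto simp: subset_iff)
  qed
  define M where "M n = affine_power d (ps 1) -` L n" for n
  have M_eq: "M n = {z. cmod (iter_map d ps (Suc n) z) \<le> 1}" for n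
    by (auto simp: M_def L_def iter_map_Suc simp del: iter_map.simps)
  have "connected (\<Inter> (range M))"
  proof (rule connected_nest)
    show "compact (M n)" "connected (M n)" for n
      unfolding M_def using connected_vimage_affine_power[OF d ps1, of "L n"] L L0 compact_imp_closed
      by auto
    show "M n \<subseteq> M m" if "m \<le> n" for m n
      using norm_iter_map_le_one_mono that by (auto simp: M_eq simp del: iter_map.simps)
  qed
  moreover have "E = \<Inter> (range M)"
    unfolding E_eq M_eq using norm_iter_map_antimono by blast
  ultimately show ?thesis by simp
qed

end

section \<open>Contraction by the inverse branches\<close>

text \<open>Moebius maps moving \<open>b\<close> and \<open>f b\<close> to 0 reduce this to the
  Schwarz lemma. Equality would turn the conjugated map into a rotation and make \<open>f\<close>
  surjective, contrary to the omitted value \<open>c\<close>.\<close>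

lemma Schwarz_Pick_strict:
  assumes hol: "f holomorphic_on ball 0 1" and into: "f ` ball 0 1 \<subseteq> ball 0 1"
    and c: "c \<in> ball 0 1" "c \<notin> f ` ball 0 1"
    and ab: "a \<in> ball 0 1" "b \<in> ball 0 1" "a \<noteq> b"
  shows "cmod (Moebius_function 0 (f b) (f a)) < cmod (Moebius_function 0 b a)"
proof -
  let ?M = "Moebius_function 0"
  define F where "F = ?M (f b) \<circ> (f \<circ> ?M (- b))"
  have f_ball: "cmod (f z) < 1" if "cmod z < 1" for z
    using into that by (auto simp: image_subset_iff)
  have b: "cmod b < 1" and a: "cmod a < 1"
    using ab by auto
  have fb: "cmod (f b) < 1"
    using f_ball b by simp
  have Mb: "?M (- b) ` ball 0 1 \<subseteq> ball 0 1"
    using Moebius_function_norm_lt_1[of "- b"] b by auto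
  have F_def': "F z = ?M (f b) (f (?M (- b) z))" for z
    by (simp add: F_def)
  have holF: "F holomorphic_on ball 0 1"
    unfolding F_def
    by (intro holomorphic_on_compose_gen[where t = "ball 0 1"] Moebius_function_holomorphic hol)
      (use Mb into b fb in auto)
  have F0: "F 0 = 0"
    by (simp add: F_def' Moebius_function_of_zero Moebius_function_eq_zero)
  have F1: "cmod (F z) < 1" if "cmod z < 1" for z
    unfolding F_def' using that b fb by (intro Moebius_function_norm_lt_1 f_ball) auto
  define \<zeta> where "\<zeta> = ?M b a"
  have \<zeta>: "cmod \<zeta> < 1"
    unfolding \<zeta>_def by (rule Moebius_function_norm_lt_1[OF b a])
  have recover: "?M (- b) \<zeta> = a"
    unfolding \<zeta>_def by (rule Moebius_function_compose) (use a b in auto)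
  have "\<zeta> \<noteq> 0"
    using recover ab(3) by (auto simp: Moebius_function_of_zero)
  have F\<zeta>: "F \<zeta> = ?M (f b) (f a)"
    by (simp add: F_def' recover)
  have "cmod (F \<zeta>) \<noteq> cmod \<zeta>"
  proof
    assume "cmod (F \<zeta>) = cmod \<zeta>"
    then have "\<exists>z. cmod z < 1 \<and> z \<noteq> 0 \<and> cmod (F z) = cmod z"
      using \<zeta> \<open>\<zeta> \<noteq> 0\<close> by blast
    then obtain \<alpha> where \<alpha>: "\<And>z. cmod z < 1 \<Longrightarrow> F z = \<alpha> * z" "cmod \<alpha> = 1"
      using Schwarz_Lemma(3)[OF holF F0 F1 \<zeta>] by blast
    \<comment> \<open>The rotation sends this point to the image of \<open>c\<close>, so
      \<open>f\<close> would attain \<open>c\<close>.\<close>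
    define z where "z = ?M (f b) c / \<alpha>"
    have "\<alpha> \<noteq> 0" using \<alpha>(2) by auto
    have z: "cmod z < 1"
      using Moebius_function_norm_lt_1[OF fb, of c 0] c(1) \<alpha>(2) by (simp add: z_def norm_divide)
    have "?M (f b) (f (?M (- b) z)) = ?M (f b) c"
      using \<alpha>(1)[OF z] \<open>\<alpha> \<noteq> 0\<close> by (simp add: F_def' z_def)
    moreover have "cmod (?M (- b) z) < 1"
      using z b by (intro Moebius_function_norm_lt_1) auto
    ultimately have "f (?M (- b) z) = c"
      using Moebius_function_compose[of "- f b" "f b"] f_ball fb c(1)
      by (metis (no_types, lifting) mem_ball_0 minus_minus norm_minus_cancel)
    then show False
      using c(2) \<open>cmod (?M (- b) z) < 1\<close> by auto
  qed
  then show ?thesis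
    using Schwarz_Lemma(1)[OF holF F0 F1 \<zeta>] F\<zeta> by (simp add: \<zeta>_def)
qed

text \<open>This is the pseudo-hyperbolic distance of \<open>U\<close>, carried over from the disc
  by a Riemann map. Its argument is a pair so that it can be maximised over a compact set of
  pairs.\<close>

lemma contracted_gauge_exists:
  assumes "open U" "simply_connected U" "U \<noteq> UNIV" "U \<noteq> {}"
  obtains \<delta> :: "complex \<times> complex \<Rightarrow> real"
  where "continuous_on (U \<times> U) \<delta>"
    and "\<And>a. a \<in> U \<Longrightarrow> \<delta> (a, a) = 0"
    and "\<And>a b. \<lbrakk>a \<in> U; b \<in> U; a \<noteq> b\<rbrakk> \<Longrightarrow> 0 < \<delta> (a, b)"
    and "\<And>f a b. \<lbrakk>f holomorphic_on U; f ` U \<subset> U; a \<in> U; b \<in> U; a \<noteq> b\<rbrakk>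
           \<Longrightarrow> \<delta> (f a, f b) < \<delta> (a, b)"
proof -
  obtain \<phi> \<psi> where hol: "\<phi> holomorphic_on U" "\<psi> holomorphic_on ball 0 1"
    and \<phi>: "\<And>z. z \<in> U \<Longrightarrow> \<phi> z \<in> ball 0 1 \<and> \<psi> (\<phi> z) = z"
    and \<psi>: "\<And>z. z \<in> ball 0 1 \<Longrightarrow> \<psi> z \<in> U \<and> \<phi> (\<psi> z) = z"
    using Riemann_mapping_theorem[of U] assms by blast
  define \<delta> where "\<delta> = (\<lambda>(a, b). cmod (Moebius_function 0 (\<phi> b) (\<phi> a)))"
  have nz: "1 - cnj (\<phi> b) * \<phi> a \<noteq> 0" if "a \<in> U" "b \<in> U" for a b
  proof -
    have "cmod (cnj (\<phi> b) * \<phi> a) < 1"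
      using \<phi>[OF that(1)] \<phi>[OF that(2)] norm_mult_less[of "cnj (\<phi> b)" 1 "\<phi> a" 1] by simp
    then show ?thesis by auto
  qed
  show thesis
  proof
    have cont: "continuous_on U \<phi>"
      using hol(1) by (rule holomorphic_on_imp_continuous_on)
    have "continuous_on (U \<times> U) (\<lambda>z. \<phi> (fst z))" "continuous_on (U \<times> U) (\<lambda>z. \<phi> (snd z))"
      by (auto intro!: continuous_on_compose2[OF cont] continuous_intros)
    then show "continuous_on (U \<times> U) \<delta>"
      unfolding \<delta>_def case_prod_unfold Moebius_function_simple
      using nz by (intro continuous_intros) auto
    show "\<delta> (a, a) = 0" if "a \<in> U" for a
      by (simp add: \<delta>_def Moebius_function_eq_zero)
    show "0 < \<delta> (a, b)" if "a \<in> U" "b \<in> U" "a \<noteq> b" for a b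
    proof -
      have "\<phi> a \<noteq> \<phi> b" using \<phi> that by metis
      then show ?thesis
        using nz[OF that(1,2)] by (simp add: \<delta>_def Moebius_function_simple)
    qed
    show "\<delta> (f a, f b) < \<delta> (a, b)"
      if f: "f holomorphic_on U" "f ` U \<subset> U" and ab: "a \<in> U" "b \<in> U" "a \<noteq> b" for f a b
    proof -
      define h where "h = \<phi> \<circ> (f \<circ> \<psi>)"
      have fU: "f w \<in> U" if "w \<in> U" for w
        using f(2) that by blast
      have h: "h (\<phi> z) = \<phi> (f z)" if "z \<in> U" for z
        using \<phi>[OF that] by (simp add: h_def)
      obtain c where c: "c \<in> U" "c \<notin> f ` U" using f(2) by blast
      have "cmod (Moebius_function 0 (h (\<phi> b)) (h (\<phi> a))) < cmod (Moebius_function 0 (\<phi> b) (\<phi> a))"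
      proof (rule Schwarz_Pick_strict)
        show "h holomorphic_on ball 0 1"
          unfolding h_def using f hol \<psi>
          by (intro holomorphic_on_compose_gen[where t = U]) auto
        show "h ` ball 0 1 \<subseteq> ball 0 1"
          using fU \<phi> \<psi> by (auto simp: h_def image_subset_iff)
        show "\<phi> c \<notin> h ` ball 0 1"
        proof
          assume "\<phi> c \<in> h ` ball 0 1"
          then obtain z where z: "z \<in> ball 0 1" "\<phi> c = \<phi> (f (\<psi> z))"
            by (auto simp: h_def)
          moreover have "f (\<psi> z) \<in> U" using fU \<psi>[OF z(1)] by blast
          ultimately have "c = f (\<psi> z)"
            using \<phi> c(1) by metis
          then show False using c(2) \<psi>[OF z(1)] by blast
        qed
        show "\<phi> a \<noteq> \<phi> b" using \<phi> ab by metis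
      qed (use \<phi> ab c in auto)
      then show ?thesis
        using h ab by (simp add: \<delta>_def)
    qed
  qed
qed

section \<open>Branches of the inverse\<close>

definition root_branch :: "nat \<Rightarrow> real \<Rightarrow> complex \<Rightarrow> complex \<Rightarrow> complex" where
  "root_branch d q u w = 1 - of_real q + of_real q * (u * exp (Ln w / of_nat d))"

text \<open>The root of unity whose branch leads from the image of \<open>z\<close> back to
  \<open>z\<close>: the affine coordinate divided by the principal root of the image. It varies
  continuously as long as the image avoids the slit.\<close>

definition branch_index :: "nat \<Rightarrow> real \<Rightarrow> complex \<Rightarrow> complex" where
  "branch_index d q z =
     ((z - (1 - of_real q)) / of_real q) / exp (Ln (affine_power d q z) / of_nat d)"

lemma exp_Ln_div_power: "0 < d \<Longrightarrow> w \<noteq> 0 \<Longrightarrow> exp (Ln w / of_nat d) ^ d = w"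
  by (simp add: exp_of_nat_mult[symmetric])

lemma affine_power_root_branch:
  assumes "0 < d" "0 < q" "u ^ d = 1" "w \<noteq> 0"
  shows "affine_power d q (root_branch d q u w) = w"
  using assms by (simp add: affine_power_def root_branch_def power_mult_distrib exp_Ln_div_power)

lemma branch_index_root_branch:
  assumes "0 < d" "0 < q" "u ^ d = 1" "w \<noteq> 0"
  shows "branch_index d q (root_branch d q u w) = u"
  using assms affine_power_root_branch[OF assms]
  by (simp add: branch_index_def) (simp add: root_branch_def)

lemma root_branch_branch_index:
  "0 < q \<Longrightarrow> root_branch d q (branch_index d q z) (affine_power d q z) = z"
  by (simp add: root_branch_def branch_index_def)

lemma branch_index_power:
  assumes "0 < d" "affine_power d q z \<noteq> 0"
  shows "branch_index d q z ^ d = 1"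
proof -
  have "branch_index d q z ^ d
      = affine_power d q z / exp (Ln (affine_power d q z) / of_nat d) ^ d"
    by (simp only: branch_index_def affine_power_def power_divide)
  then show ?thesis
    using assms by (simp add: exp_Ln_div_power)
qed

lemma continuous_on_branch_index:
  assumes "0 < d" "0 < q" "continuous_on A f" "\<And>z. z \<in> A \<Longrightarrow> affine_power d q (f z) \<notin> \<real>\<^sub>\<le>\<^sub>0"
  shows "continuous_on A (\<lambda>z. branch_index d q (f z))"
  unfolding branch_index_def using assms by (intro continuous_intros) auto

text \<open>The slit disc is starlike about 1: a segment from 1 to a nonreal point meets the real
  axis only at 1, and a real endpoint is positive.\<close>

lemma simply_connected_slit_disc:
  assumes "1 < R"
  shows "simply_connected (ball (0::complex) R - \<real>\<^sub>\<le>\<^sub>0)"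
proof (rule starlike_imp_simply_connected)
  show "starlike (ball (0::complex) R - \<real>\<^sub>\<le>\<^sub>0)"
    unfolding starlike_def
  proof (intro bexI ballI)
    show one: "1 \<in> ball (0::complex) R - \<real>\<^sub>\<le>\<^sub>0"
      using assms by auto
    fix z :: complex assume z: "z \<in> ball 0 R - \<real>\<^sub>\<le>\<^sub>0"
    have "closed_segment 1 z \<inter> \<real>\<^sub>\<le>\<^sub>0 = {}"
    proof -
      have False if w: "w \<in> closed_segment 1 z" "w \<in> \<real>\<^sub>\<le>\<^sub>0" for w
      proof -
        obtain t where t: "0 \<le> t" "t \<le> 1" "w = (1 - t) *\<^sub>R 1 + t *\<^sub>R z"
          using w(1) by (auto simp: in_segment)
        then have "1 - t + t * Re z \<le> 0" "t * Im z = 0"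
          using w(2) by (auto simp: complex_nonpos_Reals_iff)
        then have "t \<noteq> 0" "Im z = 0" by auto
        then have "0 < Re z" using z by (auto simp: complex_nonpos_Reals_iff)
        then have "0 < t * Re z" using t(1) \<open>t \<noteq> 0\<close> by simp
        then show False using \<open>1 - t + t * Re z \<le> 0\<close> t(2) by linarith
      qed
      then show ?thesis by blast
    qed
    moreover have "closed_segment 1 z \<subseteq> ball 0 R"
      using one z by (intro closed_segment_subset) auto
    ultimately show "closed_segment 1 z \<subseteq> ball 0 R - \<real>\<^sub>\<le>\<^sub>0" by blast
  qed
qed

section \<open>Contraction in the slit disc\<close>

locale escaping_slit = eventually_constant +
  fixes R :: real
  assumes R: "1 < R"
    and slit_escapes: "\<And>x. x \<le> 0 \<Longrightarrow> complex_of_real x \<notin> K"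
    and slit_image: "\<And>x. x \<le> 0 \<Longrightarrow> g (of_real x) \<notin> ball 0 R - \<real>\<^sub>\<le>\<^sub>0"
begin

abbreviation "U \<equiv> ball (0::complex) R - \<real>\<^sub>\<le>\<^sub>0"

lemma d_pos: "0 < d" using d by simp

lemma nonpos_Reals_imp_real: "z \<in> \<real>\<^sub>\<le>\<^sub>0 \<Longrightarrow> \<exists>x\<le>0. z = complex_of_real x"
  by (intro exI[of _ "Re z"]) (auto simp: complex_nonpos_Reals_iff complex_eq_iff)

lemma K_le_one: "w \<in> K \<Longrightarrow> cmod w \<le> 1"
  by (auto simp: filled_Julia_def dest: spec[of _ 0])

lemma K_subset_U: "K \<subseteq> U"
proof
  fix w assume w: "w \<in> K"
  then have "w \<notin> \<real>\<^sub>\<le>\<^sub>0"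
    using slit_escapes nonpos_Reals_imp_real by metis
  then show "w \<in> U"
    using K_le_one[OF w] R by simp
qed

lemma K_not_slit: "w \<in> K \<Longrightarrow> w \<notin> \<real>\<^sub>\<le>\<^sub>0"
  using K_subset_U by blast

lemma K_nonzero: "w \<in> K \<Longrightarrow> w \<noteq> 0"
  using K_not_slit nonpos_Reals_zero_I by blast

lemma g_mem_K:
  assumes "w \<in> K"
  shows "g w \<in> K"
proof -
  have "cmod ((g ^^ Suc n) w) \<le> 1" for n
    using assms unfolding filled_Julia_def by blast
  then show ?thesis
    by (simp add: filled_Julia_def funpow_Suc_right del: funpow.simps)
qed

lemma g_mem_K_imp:
  assumes "g w \<in> K"
  shows "w \<in> K"
proof -
  have "cmod ((g ^^ n) w) \<le> 1" for n
  proof (cases n)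
    case 0
    then show ?thesis
      using norm_affine_power_le_one_imp[OF d p(1)] p(2) K_le_one[OF assms] by simp
  next
    case (Suc m)
    then show ?thesis
      using assms by (simp add: filled_Julia_def funpow_Suc_right del: funpow.simps)
  qed
  then show ?thesis by (simp add: filled_Julia_def)
qed

lemma funpow_g_mem_K: "w \<in> K \<Longrightarrow> (g ^^ n) w \<in> K"
  by (induction n) (auto simp: g_mem_K)

lemma continuous_on_funpow_g: "continuous_on A (g ^^ n)"
  by (induction n) (auto intro!: continuous_intros p simp: comp_def)

lemma compact_K: "compact K"
proof -
  have "closed K"
    unfolding filled_Julia_def
    by (intro closed_Collect_all closed_Collect_le continuous_on_norm continuous_on_funpow_g
        continuous_on_const)
  moreover have "K \<subseteq> cball 0 1"
    using K_le_one by auto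
  ultimately show ?thesis
    using bounded_subset[OF bounded_cball] by (auto simp: compact_eq_bounded_closed)
qed

lemma root_branch_holomorphic: "root_branch d p u holomorphic_on U"
  unfolding root_branch_def using d_pos by (intro holomorphic_intros) auto

text \<open>Slit points are sent outside \<open>U\<close> and points of modulus at least
  \<open>R\<close> move outwards, so whatever \<open>g\<close> sends into \<open>U\<close> lies in
  \<open>U\<close>. The critical point \<open>1 - of_real p\<close> lies in \<open>U\<close> but on
  no branch, as the exponential never vanishes.\<close>

lemma root_branch_proper:
  assumes "u ^ d = 1"
  shows "root_branch d p u ` U \<subset> U"
proof
  show "root_branch d p u ` U \<subseteq> U"
  proof (intro image_subsetI)
    fix w assume w: "w \<in> U"
    define z where "z = root_branch d p u w"
    have gz: "g z = w"
      unfolding z_def using w assms d_pos p by (intro affine_power_root_branch) auto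
    have "z \<notin> \<real>\<^sub>\<le>\<^sub>0"
      using nonpos_Reals_imp_real slit_image gz w by metis
    moreover have "cmod z < R"
    proof (rule ccontr)
      assume "\<not> cmod z < R"
      then show False
        using norm_affine_power_escape[OF d p(1), of z] p R gz w by simp
    qed
    ultimately show "root_branch d p u w \<in> U" by (simp add: z_def)
  qed
  have "1 - complex_of_real p \<in> U"
  proof -
    have "cmod (1 - complex_of_real p) = \<bar>1 - p\<bar>"
      by (metis norm_of_real of_real_1 of_real_diff)
    then show ?thesis
      using p R by (auto simp: complex_nonpos_Reals_iff)
  qed
  moreover have "root_branch d p u w \<noteq> 1 - of_real p" for w
    using assms p d_pos by (auto simp: root_branch_def power_0_left)
  ultimately show "root_branch d p u ` U \<noteq> U" by (metis imageE)
qed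

lemma same_itinerary_imp_eq:
  assumes x: "x \<in> K" and y: "y \<in> K"
    and same: "\<And>n. branch_index d p ((g ^^ n) x) = branch_index d p ((g ^^ n) y)"
  shows "x = y"
proof (rule ccontr)
  assume "x \<noteq> y"
  have "open U"
    by (intro open_Diff) auto
  have U: "U \<noteq> UNIV" "U \<noteq> {}"
    using nonpos_Reals_zero_I x K_subset_U by blast+
  obtain \<delta> :: "complex \<times> complex \<Rightarrow> real"
    where \<delta>_cont: "continuous_on (U \<times> U) \<delta>" and \<delta>_0: "\<And>a. a \<in> U \<Longrightarrow> \<delta> (a, a) = 0"
    and \<delta>_pos: "\<And>a b. \<lbrakk>a \<in> U; b \<in> U; a \<noteq> b\<rbrakk> \<Longrightarrow> 0 < \<delta> (a, b)"
    and \<delta>_less: "\<And>f a b. \<lbrakk>f holomorphic_on U; f ` U \<subset> U; a \<in> U; b \<in> U; a \<noteq> b\<rbrakk>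
           \<Longrightarrow> \<delta> (f a, f b) < \<delta> (a, b)"
    by (rule contracted_gauge_exists[OF \<open>open U\<close> simply_connected_slit_disc[OF R] U])
      (rule that, assumption+)
  define J where "J n z = branch_index d p ((g ^^ n) (fst z)) - branch_index d p ((g ^^ n) (snd z))"
    for n and z :: "complex \<times> complex"
  \<comment> \<open>Pairs with equal itineraries form a compact set, because every branch index is
    continuous on \<open>K\<close>.\<close>
  define Q where "Q = (K \<times> K) \<inter> (\<Inter>n. {z \<in> K \<times> K. J n z = 0})"
  have J_cont: "continuous_on (K \<times> K) (J n)" for n
  proof -
    have cont: "continuous_on K (\<lambda>w. branch_index d p ((g ^^ n) w))"
      using d_pos p continuous_on_funpow_g K_not_slit g_mem_K funpow_g_mem_K
      by (intro continuous_on_branch_index) auto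
    show ?thesis
      unfolding J_def
      by (intro continuous_on_diff continuous_on_compose2[OF cont]) (auto intro: continuous_intros)
  qed
  have "compact Q"
    unfolding Q_def
    by (intro compact_Int_closed closed_INT ballI continuous_closed_preimage_constant J_cont
        compact_Times compact_imp_closed compact_K)
  moreover have xy: "(x, y) \<in> Q"
    using x y same by (auto simp: Q_def J_def)
  moreover have "continuous_on Q \<delta>"
    using K_subset_U by (intro continuous_on_subset[OF \<delta>_cont]) (auto simp: Q_def)
  ultimately obtain z where z: "z \<in> Q" "\<And>z'. z' \<in> Q \<Longrightarrow> \<delta> z' \<le> \<delta> z"
    using continuous_attains_sup[of Q \<delta>] by blast
  obtain a b where ab: "z = (a, b)" by (cases z)
  have KK: "a \<in> K" "b \<in> K" and Jn: "\<And>n. J n (a, b) = 0"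
    using z(1) by (auto simp: Q_def ab)
  have "a \<noteq> b"
  proof
    assume "a = b"
    then have "\<delta> z = 0" using \<delta>_0 KK K_subset_U ab by blast
    moreover have "0 < \<delta> (x, y)" using \<delta>_pos \<open>x \<noteq> y\<close> x y K_subset_U by blast
    ultimately show False using z(2)[OF xy] by simp
  qed
  define u where "u = branch_index d p a"
  have "g a \<noteq> 0" using K_nonzero g_mem_K KK by blast
  then have u: "u ^ d = 1"
    unfolding u_def using d_pos by (intro branch_index_power)
  have a: "a = root_branch d p u (g a)" and b: "b = root_branch d p u (g b)"
    using Jn[of 0] root_branch_branch_index[OF p(1), of d a] root_branch_branch_index[OF p(1), of d b]
    by (simp_all add: J_def u_def)
  have "g a \<noteq> g b" using a b \<open>a \<noteq> b\<close> by metis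
  \<comment> \<open>Since \<open>a\<close> and \<open>b\<close> have the same first index, one
    inverse branch takes \<open>g a\<close> and \<open>g b\<close> back to them and strictly
    contracts.\<close>
  then have "\<delta> (a, b) < \<delta> (g a, g b)"
    using \<delta>_less[OF root_branch_holomorphic root_branch_proper[OF u], of "g a" "g b"]
      a b KK g_mem_K K_subset_U by (metis subsetD)
  moreover have "(g a, g b) \<in> Q"
    using KK g_mem_K Jn[of "Suc n" for n] by (auto simp: Q_def J_def funpow_Suc_right simp del: funpow.simps)
  ultimately show False
    using z(2) ab by force
qed

section \<open>Itineraries of points of \<open>E\<close>\<close>

definition index_at :: "nat \<Rightarrow> complex \<Rightarrow> complex" where
  "index_at n x = branch_index d (ps (Suc n)) (iter_map d ps n x)"

lemma iter_map_Suc': "iter_map d ps (Suc n) x = affine_power d (ps (Suc n)) (iter_map d ps n x)"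
  by (simp add: step_map_eq)

lemma affine_power_iter_map_mem_K:
  "x \<in> E \<Longrightarrow> affine_power d (ps (Suc n)) (iter_map d ps n x) \<in> K"
  using iter_map_mem_K_iff[of n x] by (simp only: iter_map_Suc')

lemma continuous_on_iter_map: "continuous_on A (iter_map d ps n)"
proof (induction n)
  case (Suc n)
  then show ?case
    unfolding iter_map_Suc'[abs_def] using ps_bounds by (intro continuous_intros)
qed (simp add: id_def)

lemma compact_E: "compact E"
proof -
  have "closed E"
    unfolding E_eq
    by (intro closed_Collect_all closed_Collect_le continuous_on_norm continuous_on_iter_map
        continuous_on_const)
  moreover have "E \<subseteq> cball 0 1"
    unfolding E_eq by (auto dest: spec[of _ 0])
  ultimately show ?thesis
    using bounded_subset[OF bounded_cball] by (auto simp: compact_eq_bounded_closed)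
qed

lemma one_mem_E: "1 \<in> E"
proof -
  have "iter_map d ps n 1 = 1" for n
    using ps_bounds[of n for n]
    by (induction n) (auto simp: step_map_eq affine_power_def less_le)
  then show ?thesis by (simp add: E_eq)
qed

lemma index_at_power: "x \<in> E \<Longrightarrow> index_at n x ^ d = 1"
  unfolding index_at_def using d_pos K_nonzero[OF affine_power_iter_map_mem_K]
  by (intro branch_index_power) auto

lemma continuous_on_index_at: "continuous_on E (index_at n)"
  unfolding index_at_def using d_pos ps_bounds K_not_slit affine_power_iter_map_mem_K
  by (intro continuous_on_branch_index continuous_on_iter_map) auto

text \<open>The first map has its own parameter. The indices from 1 on identify the images under it,
  and index 0 then selects the same preimage.\<close>

lemma index_at_separates:
  assumes x: "x \<in> E" and y: "y \<in> E" and same: "\<And>n. index_at n x = index_at n y"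
  shows "x = y"
proof -
  let ?f = "affine_power d (ps 1)"
  have iter: "iter_map d ps (Suc n) z = (g ^^ n) (?f z)" for n z
    by (rule iter_map_Suc)
  have "?f x = ?f y"
  proof (rule same_itinerary_imp_eq)
    show "?f x \<in> K" "?f y \<in> K"
      using affine_power_iter_map_mem_K[of _ 0] x y by simp_all
    show "branch_index d p ((g ^^ n) (?f x)) = branch_index d p ((g ^^ n) (?f y))" for n
      using same[of "Suc n"] by (simp add: index_at_def ps iter del: iter_map.simps)
  qed
  moreover have "branch_index d (ps 1) x = branch_index d (ps 1) y"
    using same[of 0] by (simp add: index_at_def)
  ultimately show ?thesis
    using root_branch_branch_index[OF ps1(1)] by metis
qed

text \<open>The point \<open>w\<close> is pulled back along the branches used by \<open>x\<close>,
  the last map being undone first. Intermediate preimages stay in \<open>K\<close>, so the induction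
  can continue.\<close>

lemma iter_map_pullback:
  assumes x: "x \<in> E"
  shows "w \<in> K \<Longrightarrow> \<exists>y. iter_map d ps (Suc n) y = w \<and> (\<forall>m\<le>n. index_at m y = index_at m x)"
proof (induction n arbitrary: w)
  case 0
  let ?y = "root_branch d (ps 1) (index_at 0 x) w"
  have "affine_power d (ps 1) ?y = w" "branch_index d (ps 1) ?y = index_at 0 x"
    using d_pos ps1 index_at_power[OF x] K_nonzero[OF 0]
    by (intro affine_power_root_branch branch_index_root_branch; simp)+
  then show ?case
    by (intro exI[of _ ?y]) (auto simp: step_map_eq index_at_def)
next
  case (Suc n)
  let ?v = "root_branch d p (index_at (Suc n) x) w"
  have v: "g ?v = w" "branch_index d p ?v = index_at (Suc n) x"
    using d_pos p index_at_power[OF x] K_nonzero[OF Suc.prems]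
    by (intro affine_power_root_branch branch_index_root_branch; simp)+
  have "?v \<in> K"
    by (rule g_mem_K_imp) (simp only: v(1) Suc.prems)
  then obtain y where y: "iter_map d ps (Suc n) y = ?v" "\<forall>m\<le>n. index_at m y = index_at m x"
    using Suc.IH by blast
  have "index_at (Suc n) y = index_at (Suc n) x"
    using v(2) y(1) by (simp only: index_at_def) (simp add: ps del: iter_map.simps)
  moreover have "iter_map d ps (Suc (Suc n)) y = w"
    using v(1) y(1) by (simp add: step_map_eq ps)
  ultimately show ?case
    using y(2) by (metis le_Suc_eq)
qed

text \<open>As \<open>d\<close> is at least 2, some other root of unity gives a second preimage in
  \<open>K\<close> of \<open>g\<close> at the orbit point. Pulling it back along the branches of
  \<open>x\<close> keeps the earlier indices.\<close>

lemma exists_other_point: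
  assumes x: "x \<in> E"
  shows "\<exists>y\<in>E. y \<noteq> x \<and> (\<forall>m<n. index_at m y = index_at m x)"
proof -
  let ?w = "iter_map d ps (Suc n) x"
  have w: "?w \<in> K"
    using x iter_map_mem_K_iff by blast
  have "card {u::complex. u ^ d = 1} = d"
    using d_pos by (rule card_roots_unity_eq)
  then have "\<not> {u::complex. u ^ d = 1} \<subseteq> {branch_index d p ?w}"
    using d card_mono[of "{branch_index d p ?w}" "{u::complex. u ^ d = 1}"] by auto
  then obtain u where u: "u ^ d = 1" "u \<noteq> branch_index d p ?w" by blast
  let ?v = "root_branch d p u (g ?w)"
  have gw: "g ?w \<in> K" using w by (rule g_mem_K)
  have v: "g ?v = g ?w" "branch_index d p ?v = u"
    using d_pos p u(1) K_nonzero[OF gw]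
    by (intro affine_power_root_branch branch_index_root_branch; simp)+
  have "?v \<in> K"
    by (rule g_mem_K_imp) (simp only: v(1) gw)
  then obtain y where y: "iter_map d ps (Suc n) y = ?v" "\<forall>m\<le>n. index_at m y = index_at m x"
    using iter_map_pullback[OF x] by blast
  have "y \<in> E"
    using y(1) \<open>?v \<in> K\<close> iter_map_mem_K_iff by metis
  moreover have "y \<noteq> x"
    using y(1) v(2) u(2) by metis
  ultimately show ?thesis
    using y(2) by auto
qed

theorem is_Cantor_set_E: "is_Cantor_set E"
proof -
  let ?r = "{u::complex. u ^ d = 1}"
  \<comment> \<open>A pair of a time and a numbered root of unity is coded by one natural
    number.\<close>
  define B where "B i = (case prod_decode i of (n, k) \<Rightarrow> {x. index_at n x = from_nat_into ?r k})" for i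
  have finite_r: "finite ?r"
    using d_pos card_roots_unity_eq[of d] card_ge_0_finite by fastforce
  have closed_vimage: "closed (E \<inter> index_at n -` T)" if "finite T" for n T
    using that continuous_on_index_at compact_imp_closed[OF compact_E] finite_imp_closed
    by (intro continuous_closed_preimage)
  have "Cantor_separation E B"
  proof
    show "closed (E \<inter> B i)" for i
    proof -
      obtain n k where i: "prod_decode i = (n, k)" by (cases "prod_decode i")
      have "E \<inter> B i = E \<inter> index_at n -` {from_nat_into ?r k}"
        by (auto simp: B_def i)
      then show ?thesis using closed_vimage by simp
    qed
    show "closed (E - B i)" for i
    proof -
      obtain n k where i: "prod_decode i = (n, k)" by (cases "prod_decode i")
      \<comment> \<open>All indices are roots of unity, so the complement is again the preimage of a
        finite set.\<close>
      have "E - B i = E \<inter> index_at n -` (?r - {from_nat_into ?r k})"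
        using index_at_power by (auto simp: B_def i)
      then show ?thesis using closed_vimage[of "?r - {from_nat_into ?r k}"] finite_r by simp
    qed
    show "x = y" if xy: "x \<in> E" "y \<in> E" "\<And>i. x \<in> B i \<longleftrightarrow> y \<in> B i" for x y
    proof (rule index_at_separates[OF xy(1,2)])
      fix n
      have "index_at n x \<in> ?r" using index_at_power[OF xy(1)] by simp
      then obtain k where k: "from_nat_into ?r k = index_at n x"
        using from_nat_into_surj[OF countable_finite[OF finite_r]] by blast
      then show "index_at n x = index_at n y"
        using xy(3)[of "prod_encode (n, k)"] by (simp add: B_def)
    qed
    show "\<exists>y\<in>E. y \<noteq> x \<and> (\<forall>i<n. y \<in> B i \<longleftrightarrow> x \<in> B i)" if x: "x \<in> E" for x n
    proof -
      obtain y where y: "y \<in> E" "y \<noteq> x" "\<forall>m<n. index_at m y = index_at m x"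
        using exists_other_point[OF x] by blast
      have "y \<in> B i \<longleftrightarrow> x \<in> B i" if "i < n" for i
      proof -
        obtain m k where mk: "prod_decode i = (m, k)" by (cases "prod_decode i")
        then have "i = prod_encode (m, k)" by (metis prod_decode_inverse)
        \<comment> \<open>The pairing code is at least its first component, so agreement of the
          first \<open>n\<close> indices settles the first \<open>n\<close> sets.\<close>
        then have "m < n"
          using le_prod_encode_1[of m k] that by simp
        then show ?thesis using y(3) by (simp add: B_def mk)
      qed
      then show ?thesis using y(1,2) by blast
    qed
  qed (use compact_E one_mem_E in blast)+
  then show ?thesis by (rule Cantor_separation.is_Cantor_set)
qed

end

section \<open>The real map\<close>

lemma theta_root_less_imp:
  assumes "2 \<le> d" "0 \<le> x" "x < y"
  shows "real d * x ^ (d - 1) + (real d - 1) * x ^ d < real d * y ^ (d - 1) + (real d - 1) * y ^ d"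
proof -
  have "real d * x ^ (d - 1) < real d * y ^ (d - 1)"
    using assms by (intro mult_strict_left_mono power_strict_mono) auto
  moreover have "(real d - 1) * x ^ d < (real d - 1) * y ^ d"
    using assms by (intro mult_strict_left_mono power_strict_mono) auto
  ultimately show ?thesis by linarith
qed

lemma ex1_theta_root:
  assumes d: "2 \<le> d"
  shows "\<exists>!x. theta_root d x"
proof -
  let ?P = "\<lambda>x::real. real d * x ^ (d - 1) + (real d - 1) * x ^ d - 1"
  have "\<exists>x. 0 \<le> x \<and> x \<le> 1 \<and> ?P x = 0"
    using d by (intro IVT') (auto intro!: continuous_intros simp: power_0_left)
  then obtain x where "theta_root d x" by (auto simp: theta_root_def)
  moreover have "y = z" if "theta_root d y" "theta_root d z" for y z
    using that theta_root_less_imp[OF d, of y z] theta_root_less_imp[OF d, of z y]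
    unfolding theta_root_def by (cases y z rule: linorder_cases) auto
  ultimately show ?thesis by blast
qed

lemma theta_root_theta: "2 \<le> d \<Longrightarrow> theta_root d (theta d)"
  unfolding theta_def by (rule theI') (rule ex1_theta_root)

lemma theta_bounds:
  assumes d: "2 \<le> d"
  shows "0 < theta d" "theta d < 1"
proof -
  have root: "0 \<le> theta d" "real d * theta d ^ (d - 1) + (real d - 1) * theta d ^ d = 1"
    using theta_root_theta[OF d] by (auto simp: theta_root_def)
  then show "0 < theta d"
    using d by (cases "theta d = 0") (auto simp: power_0_left)
  show "theta d < 1"
  proof (rule ccontr)
    assume "\<not> theta d < 1"
    then have "1 \<le> theta d ^ (d - 1)" "1 \<le> theta d ^ d" by (auto intro: one_le_power)
    then have "real d * 1 + (real d - 1) * 1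
        \<le> real d * theta d ^ (d - 1) + (real d - 1) * theta d ^ d"
      using d by (intro add_mono mult_left_mono) auto
    then show False using d root(2) by simp
  qed
qed

text \<open>The equation for \<open>theta d\<close> says that the derivative of
  \<open>(t ^ d + 1) / (t + 1)\<close> vanishes there, and \<open>vartheta d\<close> is the value at
  this critical point.\<close>

lemma vartheta_theta:
  assumes d: "2 \<le> d"
  shows "vartheta d * (theta d + 1) = theta d ^ d + 1"
proof -
  have "real d * theta d ^ (d - 1) + (real d - 1) * theta d ^ d = 1"
    using theta_root_theta[OF d] by (simp add: theta_root_def)
  moreover have "theta d ^ d = theta d ^ (d - 1) * theta d"
    using power_minus_mult[of d "theta d"] d by simp
  ultimately show ?thesis
    by (simp add: vartheta_def algebra_simps)
qed

text \<open>By convexity \<open>t ^ d\<close> lies above its tangent at \<open>theta d\<close>, so \<open>vartheta d\<close> is the minimum of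
  \<open>(t ^ d + 1) / (t + 1)\<close> over \<open>t \<ge> 0\<close>.\<close>

lemma vartheta_le:
  assumes d: "2 \<le> d" and t: "0 \<le> t"
  shows "vartheta d * (t + 1) \<le> t ^ d + 1"
proof -
  define \<theta> where "\<theta> = theta d"
  have \<theta>: "0 < \<theta>" using theta_bounds[OF d] by (simp add: \<theta>_def)
  have pow: "\<theta> ^ d = \<theta> ^ (d - 1) * \<theta>"
    using power_minus_mult[of d \<theta>] d by simp
  have "1 + real d * (t / \<theta> - 1) \<le> (1 + (t / \<theta> - 1)) ^ d"
    using t \<theta> by (intro Bernoulli_inequality) simp
  then have "\<theta> ^ d * (1 + real d * (t / \<theta> - 1)) \<le> \<theta> ^ d * (t / \<theta>) ^ d"
    using \<theta> by (intro mult_left_mono) auto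
  also have "\<dots> = t ^ d"
    using \<theta> by (simp add: power_divide)
  also have "\<theta> ^ d * (1 + real d * (t / \<theta> - 1)) = \<theta> ^ d + real d * \<theta> ^ (d - 1) * (t - \<theta>)"
    using \<theta> by (simp add: pow field_simps)
  finally have "\<theta> ^ d + vartheta d * (t - \<theta>) \<le> t ^ d"
    by (simp add: vartheta_def \<theta>_def)
  then show ?thesis
    using vartheta_theta[OF d] by (simp add: \<theta>_def algebra_simps)
qed

section \<open>Real orbits and the fate of the critical value\<close>

definition real_affine_power :: "nat \<Rightarrow> real \<Rightarrow> real \<Rightarrow> real" where
  "real_affine_power d q x = ((x - (1 - q)) / q) ^ d"

lemma affine_power_of_real: "affine_power d q (of_real x) = of_real (real_affine_power d q x)"
  by (simp add: affine_power_def real_affine_power_def)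

lemma funpow_affine_power_of_real:
  "(affine_power d q ^^ n) (of_real x) = of_real ((real_affine_power d q ^^ n) x)"
  by (induction n) (auto simp: affine_power_of_real)

context eventually_constant
begin

abbreviation "\<gamma> \<equiv> real_affine_power d p"

lemma of_real_mem_K_iff: "complex_of_real x \<in> K \<longleftrightarrow> (\<forall>n. \<bar>(\<gamma> ^^ n) x\<bar> \<le> 1)"
  by (simp add: filled_Julia_def funpow_affine_power_of_real)

text \<open>An invariant interval traps the orbit of 0. Its left end will be 0 for even
  \<open>d\<close> and \<open>- (theta d ^ d)\<close> for odd \<open>d\<close>.\<close>

lemma zero_mem_K:
  assumes a: "-1 \<le> a" "a \<le> 0" and invariant: "\<And>x. a \<le> x \<Longrightarrow> x \<le> 1 \<Longrightarrow> a \<le> \<gamma> x \<and> \<gamma> x \<le> 1"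
  shows "0 \<in> K"
proof -
  have "a \<le> (\<gamma> ^^ n) 0 \<and> (\<gamma> ^^ n) 0 \<le> 1" for n
    by (induction n) (use a invariant in auto)
  then have "\<bar>(\<gamma> ^^ n) 0\<bar> \<le> 1" for n
    using a(1) by (smt (verit))
  then show ?thesis
    using of_real_mem_K_iff[of 0] by simp
qed

text \<open>For \<open>p\<close> at least \<open>1 / 2\<close> the affine part sends the unit
  interval into [-1, 1], and the even power brings it back.\<close>

lemma zero_mem_K_even:
  assumes "even d" "1 / 2 \<le> p"
  shows "0 \<in> K"
proof (rule zero_mem_K[of 0])
  fix x :: real assume x: "0 \<le> x" "x \<le> 1"
  have "\<bar>(x - (1 - p)) / p\<bar> \<le> 1"
    using x assms(2) p by (auto simp: abs_le_iff field_simps)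
  then have "\<bar>(x - (1 - p)) / p\<bar> ^ d \<le> 1"
    by (intro power_le_one) auto
  then show "0 \<le> \<gamma> x \<and> \<gamma> x \<le> 1"
    using assms(1) unfolding real_affine_power_def power_even_abs[OF assms(1)]
    by (simp only: zero_le_even_power)
qed auto

text \<open>By \<open>vartheta_theta\<close>, the affine part sends the left end to a point not
  below \<open>- theta d\<close>, and the odd power takes \<open>- theta d\<close> back to the left
  end.\<close>

lemma zero_mem_K_odd:
  assumes "odd d" "vartheta d \<le> p"
  shows "0 \<in> K"
proof (rule zero_mem_K)
  show "-1 \<le> - (theta d ^ d)" "- (theta d ^ d) \<le> 0"
    using theta_bounds[OF d] by (auto intro: power_le_one)
  fix x assume x: "- (theta d ^ d) \<le> x" "x \<le> 1"
  define u where "u = (x - (1 - p)) / p"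
  have "theta d ^ d + 1 \<le> p * (theta d + 1)"
    unfolding vartheta_theta[OF d, symmetric]
    using assms(2) theta_bounds[OF d] by (intro mult_right_mono) auto
  then have "- theta d \<le> u"
    using x p by (simp add: u_def field_simps)
  then have "(- theta d) ^ d \<le> u ^ d"
    using assms(1) by (intro power_mono_odd)
  moreover have "u ^ d \<le> 1 ^ d"
    using x p assms(1) by (intro power_mono_odd) (auto simp: u_def field_simps)
  ultimately show "- (theta d ^ d) \<le> \<gamma> x \<and> \<gamma> x \<le> 1"
    using assms(1) by (simp add: real_affine_power_def u_def[symmetric])
qed

text \<open>The even power is decreasing on the slit and sends it to reals not below
  \<open>\<gamma> 0\<close>, which exceeds 1. Slit points leave the disc in one step, and the radius
  \<open>\<gamma> 0\<close> keeps their images out of the ball.\<close>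

lemma escaping_slit_even:
  assumes "even d" "p < 1 / 2"
  shows "escaping_slit d p ps (\<gamma> 0)"
proof
  have \<gamma>: "\<gamma> x = ((1 - p - x) / p) ^ d" for x
  proof -
    have "(x - (1 - p)) / p = - ((1 - p - x) / p)"
      by (simp add: minus_divide_left)
    then show ?thesis
      unfolding real_affine_power_def using assms(1) by (metis power_minus_even)
  qed
  show R: "1 < \<gamma> 0"
    unfolding \<gamma> using assms(2) p d by (intro one_less_power) (auto simp: field_simps)
  have large: "\<gamma> 0 \<le> \<gamma> x" if "x \<le> 0" for x
    unfolding \<gamma> using that p by (intro power_mono divide_right_mono) auto
  show "complex_of_real x \<notin> K" if "x \<le> 0" for x
  proof
    assume "complex_of_real x \<in> K"
    then have "\<bar>(\<gamma> ^^ 1) x\<bar> \<le> 1"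
      unfolding of_real_mem_K_iff by blast
    then show False using large[OF that] R by simp
  qed
  show "g (complex_of_real x) \<notin> ball 0 (\<gamma> 0) - \<real>\<^sub>\<le>\<^sub>0" if "x \<le> 0" for x
    using large[OF that] R by (simp add: affine_power_of_real)
qed

text \<open>Writing \<open>x\<close> as \<open>- (t ^ d)\<close> removes the outer power: it
  suffices to compare \<open>t\<close> with \<open>(1 - p - x) / p\<close>.\<close>

lemma real_affine_power_less:
  assumes "odd d" "p < vartheta d" "x \<le> 0"
  shows "\<gamma> x < x"
proof -
  define t where "t = root d (- x)"
  have t: "0 \<le> t" "t ^ d = - x"
    using assms(3) d by (auto simp: t_def)
  have "p * (t + 1) < vartheta d * (t + 1)"
    using assms(2) t(1) by (intro mult_strict_right_mono) auto
  also have "\<dots> \<le> t ^ d + 1"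
    by (rule vartheta_le[OF d t(1)])
  finally have "t < (1 - p - x) / p"
    using t(2) p by (simp add: field_simps)
  then have "t ^ d < ((1 - p - x) / p) ^ d"
    using t(1) d by (intro power_strict_mono) auto
  moreover have "\<gamma> x = - (((1 - p - x) / p) ^ d)"
  proof -
    have "(x - (1 - p)) / p = - ((1 - p - x) / p)"
      by (simp add: minus_divide_left)
    then show ?thesis
      unfolding real_affine_power_def using assms(1) by (metis power_minus_odd)
  qed
  ultimately show ?thesis using t(2) by simp
qed

text \<open>A bounded orbit on the slit would decrease to a fixed point of \<open>\<gamma>\<close>
  on the slit, and there is none. The slit is mapped into itself, so any radius above 1
  serves.\<close>

lemma escaping_slit_odd:
  assumes "odd d" "p < vartheta d"
  shows "escaping_slit d p ps 2"
proof
  have less: "\<gamma> x < x" if "x \<le> 0" for x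
    using real_affine_power_less assms that by blast
  show "complex_of_real x \<notin> K" if x: "x \<le> 0" for x
  proof
    assume "complex_of_real x \<in> K"
    then have bound: "-1 \<le> (\<gamma> ^^ n) x" for n
      unfolding of_real_mem_K_iff by (smt (verit))
    have nonpos: "(\<gamma> ^^ n) x \<le> 0" for n
    proof (induction n)
      case (Suc n)
      then show ?case using less[OF Suc] by simp
    qed (simp add: x)
    have "decseq (\<lambda>n. (\<gamma> ^^ n) x)"
      using less nonpos by (intro decseq_SucI) (simp add: less_imp_le)
    then obtain L where L: "(\<lambda>n. (\<gamma> ^^ n) x) \<longlonglongrightarrow> L"
      using decseq_convergent bound by metis
    have "L \<le> 0"
      using L nonpos by (intro LIMSEQ_le_const2[OF L]) auto
    have "(\<lambda>n. \<gamma> ((\<gamma> ^^ n) x)) \<longlonglongrightarrow> \<gamma> L"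
      unfolding real_affine_power_def[of d p L]
      by (subst real_affine_power_def) (use p in \<open>intro tendsto_intros L; simp\<close>)
    moreover have "(\<lambda>n. \<gamma> ((\<gamma> ^^ n) x)) \<longlonglongrightarrow> L"
      using LIMSEQ_Suc[OF L] by simp
    ultimately have "\<gamma> L = L" by (rule LIMSEQ_unique)
    then show False using less[OF \<open>L \<le> 0\<close>] by simp
  qed
  show "g (complex_of_real x) \<notin> ball 0 2 - \<real>\<^sub>\<le>\<^sub>0" if "x \<le> 0" for x
    using less[OF that] that by (simp add: affine_power_of_real)
qed simp

end

theorem proposition4p4:
  fixes d :: nat and p :: real and ps :: "nat \<Rightarrow> real" and E :: "complex set"
  assumes "d \<ge> 2"
    and "0 < p" "p < 1"
    and "0 < ps 1" "ps 1 \<le> 1"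
    and "\<forall>j\<ge>2. ps j = p"
  defines "E \<equiv> bounded_orbit_set d ps"
  shows "(even d \<longrightarrow>
            (connected E \<longleftrightarrow> p \<ge> 1 / 2) \<and> (\<not> connected E \<longrightarrow> is_Cantor_set E))
       \<and> (odd d \<longrightarrow>
            (\<exists>!x. theta_root d x) \<and> 0 < theta d \<and> theta d < 1
          \<and> (connected E \<longleftrightarrow> p \<ge> vartheta d) \<and> (\<not> connected E \<longrightarrow> is_Cantor_set E))"
proof -
  interpret eventually_constant d p ps
    using assms by unfold_locales auto
  \<comment> \<open>If \<open>Q\<close> fails, \<open>E\<close> is a Cantor set and hence
    disconnected, which gives the converse direction of the equivalence.\<close>
  have dichotomy: "(connected E \<longleftrightarrow> Q) \<and> (\<not> connected E \<longrightarrow> is_Cantor_set E)"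
    if "Q \<Longrightarrow> 0 \<in> filled_Julia d p" "\<not> Q \<Longrightarrow> \<exists>R. escaping_slit d p ps R" for Q
    using that connected_E escaping_slit.is_Cantor_set_E is_Cantor_set_imp_not_connected
    unfolding E_def by blast
  have "(connected E \<longleftrightarrow> p \<ge> 1 / 2) \<and> (\<not> connected E \<longrightarrow> is_Cantor_set E)" if "even d"
    by (rule dichotomy) (meson that zero_mem_K_even escaping_slit_even not_le)+
  moreover have "(connected E \<longleftrightarrow> p \<ge> vartheta d) \<and> (\<not> connected E \<longrightarrow> is_Cantor_set E)" if "odd d"
    by (rule dichotomy) (meson that zero_mem_K_odd escaping_slit_odd not_le)+
  ultimately show ?thesis
    using ex1_theta_root theta_bounds assms(1) by blast
qed

end
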